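(* For all $s,t\in\mathbb R$ and $\xi,\eta>0$, the even and odd Pearcey kernels and the hard-edge Pearcey kernels with parameter $\mp1/2$ are related by $$K^{\mathrm P,\mathrm{even}}_{s,t}(\xi,\eta)=\frac{\eta}{\sqrt2}\,K^{\mathrm P,(-1/2)}_{s/\sqrt2,\,t/\sqrt2}\bigl(2^{-3/2}\xi^2,2^{-3/2}\eta^2\bigr),$$ $$K^{\mathrm P,\mathrm{odd}}_{s,t}(\xi,\eta)=\frac{\xi}{\sqrt2}\,K^{\mathrm P,(1/2)}_{s/\sqrt2,\,t/\sqrt2}\bigl(2^{-3/2}\xi^2,2^{-3/2}\eta^2\bigr).$$
   Context: **Pearcey kernel.** $K^{\mathrm P}_{s,t}(\xi,\eta)=\widetilde K^{\mathrm P}_{s,t}(\xi,\eta)-1_{s<t}\phi_{s,t}(\xi,\eta)$, where $\phi_{s,t}(\xi,\eta)=\frac1{\sqrt{2\pi(t-s)}}e^{-\frac{(\xi-\eta)^2}{2(t-s)}}$ and $$\widetilde K^{\mathrm P}_{s,t}(\xi,\eta)=\frac{i}{(2\pi i)^2}\int_Xdz\int_{\mathbb R}dw\,\frac{e^{z^4/4+sz^2/2+i\xi z}}{e^{w^4/4+tw^2/2+i\eta w}}\frac1{z-w},$$ $X$ consisting of four rays: from $e^{\pi i/4}\infty$ to $0$, from $e^{5\pi i/4}\infty$ to $0$, from $0$ to $e^{3\pi i/4}\infty$, and from $0$ to $e^{7\pi i/4}\infty$. Set $K^{\mathrm P,\mathrm{even}}_{s,t}(\xi,\eta)=K^{\mathrm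 P}_{s,t}(\xi,\eta)+K^{\mathrm P}_{s,t}(\xi,-\eta)$ and $K^{\mathrm P,\mathrm{odd}}_{s,t}(\xi,\eta)=K^{\mathrm P}_{s,t}(\xi,\eta)-K^{\mathrm P}_{s,t}(\xi,-\eta)$. **Hard-edge Pearcey kernel.** For $\alpha>-1$ and $x,y>0$, $K^{\mathrm P,(\alpha)}_{s,t}(x,y)=\widetilde K^{\mathrm P,(\alpha)}_{s,t}(x,y)-1_{s<t}\phi^{(\alpha)}_{s,t}(x,y)$, where $$\widetilde K^{\mathrm P,(\alpha)}_{s,t}(x,y)=\Bigl(\frac yx\Bigr)^{\alpha/2}\frac{2}{\pi i}\int_Cdv\int_0^\infty du\,\Bigl(\frac uv\Bigr)^{\alpha}\frac{uv}{v^2-u^2}\frac{e^{v^4/2+sv^2}}{e^{u^4/2+tu^2}}J_\alpha(2\sqrt y\,u)J_\alpha(2\sqrt x\,v),$$ $$\phi^{(\alpha)}_{s,t}(x,y)=\frac1{t-s}\Bigl(\frac yx\Bigr)^{\alpha/2}e^{-\frac{x+y}{t-s}}I_\alpha\Bigl(\frac{2\sqrt{xy}}{t-s}\Bigr).$$ Here $J_\alpha$ and $I_\alpha$ are the Bessel function and the modified Bessel function of the first kind, and $C$ consists of the ray from $e^{i\pi/4}\infty$ to $0$ followed by the ray from $0$ to $e^{-i\pi/4}\infty$. *)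

theory Defs
  imports "HOL-Analysis.Analysis"
begin

text \<open>
  All integrals below are iterated Lebesgue integrals. They converge absolutely:
  on every ray that occurs \<open>z ^ 4 = - r ^ 4\<close>, which gives the decay at infinity, and since the
  contours meet the line of the inner integration only at \<open>0\<close>, at a nonzero angle, the
  singularity of the integrand at the origin is integrable in two dimensions.
\<close>

text \<open>
  The contour integral along the ray from \<open>0\<close> to \<open>\<infinity>\<close> in direction \<open>cis \<theta>\<close>; a ray
  traversed from infinity to \<open>0\<close> enters with a minus sign.
\<close>

definition ray_integral :: "real \<Rightarrow> (complex \<Rightarrow> complex) \<Rightarrow> complex" where
  "ray_integral \<theta> f = (LBINT r:{0<..}. f (complex_of_real r * cis \<theta>) * cis \<theta>)"

definition X_integral :: "(complex \<Rightarrow> complex) \<Rightarrow> complex" where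
  "X_integral f =
     - ray_integral (pi / 4) f - ray_integral (5 * pi / 4) f
     + ray_integral (3 * pi / 4) f + ray_integral (7 * pi / 4) f"

definition C_integral :: "(complex \<Rightarrow> complex) \<Rightarrow> complex" where
  "C_integral f = - ray_integral (pi / 4) f + ray_integral (- pi / 4) f"


definition pearcey_phi :: "real \<Rightarrow> real \<Rightarrow> real \<Rightarrow> real \<Rightarrow> real" where
  "pearcey_phi s t \<xi> \<eta> =
     1 / sqrt (2 * pi * (t - s)) * exp (- ((\<xi> - \<eta>)\<^sup>2 / (2 * (t - s))))"

definition pearcey_tilde :: "real \<Rightarrow> real \<Rightarrow> real \<Rightarrow> real \<Rightarrow> complex" where
  "pearcey_tilde s t \<xi> \<eta> =
     \<i> / (2 * complex_of_real pi * \<i>)\<^sup>2 *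
     X_integral (\<lambda>z. LBINT w.
       exp (z ^ 4 / 4 + complex_of_real s * z\<^sup>2 / 2 + \<i> * complex_of_real \<xi> * z) /
       exp ((complex_of_real w) ^ 4 / 4 + complex_of_real t * (complex_of_real w)\<^sup>2 / 2
            + \<i> * complex_of_real \<eta> * complex_of_real w) *
       (1 / (z - complex_of_real w)))"

definition pearcey_kernel :: "real \<Rightarrow> real \<Rightarrow> real \<Rightarrow> real \<Rightarrow> complex" where
  "pearcey_kernel s t \<xi> \<eta> =
     pearcey_tilde s t \<xi> \<eta> - (if s < t then complex_of_real (pearcey_phi s t \<xi> \<eta>) else 0)"

definition pearcey_kernel_even :: "real \<Rightarrow> real \<Rightarrow> real \<Rightarrow> real \<Rightarrow> complex" where
  "pearcey_kernel_even s t \<xi> \<eta> = pearcey_kernel s t \<xi> \<eta> + pearcey_kernel s t \<xi> (- \<eta>)"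

definition pearcey_kernel_odd :: "real \<Rightarrow> real \<Rightarrow> real \<Rightarrow> real \<Rightarrow> complex" where
  "pearcey_kernel_odd s t \<xi> \<eta> = pearcey_kernel s t \<xi> \<eta> - pearcey_kernel s t \<xi> (- \<eta>)"


text \<open>
  Bessel functions of the first kind and of real order, with the principal branch of the
  power \<open>(z / 2) powr \<alpha>\<close>, cut along the nonpositive reals. Because \<open>0 powr 0 = 0\<close> here, the
  value at \<open>z = 0\<close> for \<open>\<alpha> = 0\<close> is not the usual one; the kernels only use \<open>z \<noteq> 0\<close>, always
  in the open right half-plane. Using \<open>rGamma\<close> makes the coefficients vanish at the poles
  of Gamma.
\<close>

definition bessel_J :: "real \<Rightarrow> complex \<Rightarrow> complex" where
  "bessel_J \<alpha> z = (z / 2) powr complex_of_real \<alpha> *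
     (\<Sum>k. (-1) ^ k / fact k * rGamma (complex_of_real (real k + \<alpha> + 1)) * (z / 2) ^ (2 * k))"

definition bessel_I :: "real \<Rightarrow> complex \<Rightarrow> complex" where
  "bessel_I \<alpha> z = (z / 2) powr complex_of_real \<alpha> *
     (\<Sum>k. 1 / fact k * rGamma (complex_of_real (real k + \<alpha> + 1)) * (z / 2) ^ (2 * k))"


text \<open>
  The hard-edge kernels are meant for \<open>\<alpha> > - 1\<close> and \<open>x, y > 0\<close>. On the contour \<open>v\<close> has
  argument \<open>\<plusminus> pi / 4\<close>, so the principal branch of \<open>(u / v) powr \<alpha>\<close> is the natural one.
\<close>

definition hard_pearcey_phi :: "real \<Rightarrow> real \<Rightarrow> real \<Rightarrow> real \<Rightarrow> real \<Rightarrow> complex" where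
  "hard_pearcey_phi \<alpha> s t x y =
     1 / complex_of_real (t - s) * complex_of_real ((y / x) powr (\<alpha> / 2)) *
     complex_of_real (exp (- ((x + y) / (t - s)))) *
     bessel_I \<alpha> (complex_of_real (2 * sqrt (x * y) / (t - s)))"

definition hard_pearcey_tilde :: "real \<Rightarrow> real \<Rightarrow> real \<Rightarrow> real \<Rightarrow> real \<Rightarrow> complex" where
  "hard_pearcey_tilde \<alpha> s t x y =
     complex_of_real ((y / x) powr (\<alpha> / 2)) * (2 / (complex_of_real pi * \<i>)) *
     C_integral (\<lambda>v. LBINT u:{0<..}.
       (complex_of_real u / v) powr complex_of_real \<alpha> *
       (complex_of_real u * v / (v\<^sup>2 - (complex_of_real u)\<^sup>2)) *
       (exp (v ^ 4 / 2 + complex_of_real s * v\<^sup>2) /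
        exp ((complex_of_real u) ^ 4 / 2 + complex_of_real t * (complex_of_real u)\<^sup>2)) *
       bessel_J \<alpha> (2 * complex_of_real (sqrt y) * complex_of_real u) *
       bessel_J \<alpha> (2 * complex_of_real (sqrt x) * v))"

definition hard_pearcey_kernel :: "real \<Rightarrow> real \<Rightarrow> real \<Rightarrow> real \<Rightarrow> real \<Rightarrow> complex" where
  "hard_pearcey_kernel \<alpha> s t x y =
     hard_pearcey_tilde \<alpha> s t x y - (if s < t then hard_pearcey_phi \<alpha> s t x y else 0)"

end

theory Submission
  imports Defs
begin

text \<open>
  Replacing \<open>\<eta>\<close> by \<open>- \<eta>\<close> and folding the \<open>w\<close>-line at \<open>0\<close> turns the inner integrand into
  \<open>cos (\<eta> w) z / (z\<^sup>2 - w\<^sup>2)\<close> in the even case and \<open>sin (\<eta> w) w / (z\<^sup>2 - w\<^sup>2)\<close> in the odd case.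
  As a function of \<open>z\<close> it is odd respectively even, and \<open>X\<close> is \<open>C\<close> together with \<open>- C\<close>, so
  folding \<open>X\<close> replaces \<open>exp (\<i> \<xi> z)\<close> by \<open>2 cos (\<xi> z)\<close> respectively \<open>2 \<i> sin (\<xi> z)\<close>. Since Bessel
  functions of order \<open>\<plusminus> 1 / 2\<close> are elementary, this is the hard-edge integral after rescaling
  both variables by \<open>2 powr (- 1 / 4)\<close>. Folding \<open>X\<close> needs absolute convergence on each ray, which
  follows from \<open>\<bar>z - w\<bar> \<ge> \<bar>z w\<bar> powr (1 / 2) / 2\<close> on the diagonals.
\<close>

section \<open>Absolute convergence\<close>

text \<open>One majorant serves both variables: \<open>b\<close> takes up the growth of
  \<open>exp (\<i> * \<xi> * z)\<close> in the modulus of \<open>z\<close>, \<open>a\<close> the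
  quadratic term in \<open>w\<close>, and the power \<open>- 1 / 2\<close> is each variable's share
  of the singularity of \<open>1 / (z - w)\<close>.\<close>

definition decay :: "real \<Rightarrow> real \<Rightarrow> real \<Rightarrow> real" where
  "decay a b x = x powr (- 1 / 2) * exp (a * x\<^sup>2 + b * x - x ^ 4 / 4)"

lemma decay_measurable [measurable]: "decay a b \<in> borel_measurable borel"
  unfolding decay_def by measurable

text \<open>The quartic term beats every lower one, so \<open>decay a b\<close> is at most a
  constant times the integrand \<open>x powr (- 1 / 2) / exp x\<close> of
  \<open>Gamma (1 / 2)\<close>.\<close>

lemma integrable_decay: "set_integrable lborel {0<..} (decay a b)"
proof -
  have meas: "(\<lambda>x::real. indicator {0..} x * x powr (1 / 2 - 1) / exp x) \<in> borel_measurable lborel"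
    by measurable
  have "integrable lborel (\<lambda>x::real. indicator {0..} x * x powr (1 / 2 - 1) / exp x)"
  proof (rule integrableI_nonneg[OF meas])
    show "(\<integral>\<^sup>+x. ennreal (indicator {0..} x * x powr (1 / 2 - 1) / exp x) \<partial>lborel) < \<infinity>"
      using Gamma_conv_nn_integral_real[of "1 / 2"]
      by (metis ennreal_less_top half_gt_zero_iff infinity_ennreal_def zero_less_one)
  qed simp
  then have *: "set_integrable lborel {0..} (\<lambda>x::real. x powr (- 1 / 2) / exp x)"
    by (simp add: set_integrable_def)
  \<comment> \<open>Using \<open>b + 1\<close> instead of \<open>b\<close> leaves \<open>- x\<close>
    in the exponent. After \<open>x \<le> 1 + x^2\<close>, \<open>c\<close> bounds the total
    coefficient of \<open>x^2\<close>, and \<open>c * x^2 \<le> x^4 / 4 + c^2\<close> absorbs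
    it.\<close>
  define c where "c = \<bar>a\<bar> + \<bar>b + 1\<bar>"
  have "set_integrable lborel {0<..} (\<lambda>x::real. exp (c\<^sup>2 + \<bar>b + 1\<bar>) * (x powr (- 1 / 2) / exp x))"
    by (intro set_integrable_mult_right set_integrable_subset[OF *]) auto
  then show ?thesis
  proof (rule set_integrable_bound)
    show "set_borel_measurable lborel {0<..} (decay a b)"
      unfolding set_borel_measurable_def by measurable
    have "a * x\<^sup>2 + b * x - x ^ 4 / 4 \<le> c\<^sup>2 + \<bar>b + 1\<bar> - x" if "x > 0" for x
    proof -
      have "0 \<le> (x - 1)\<^sup>2" by simp
      then have "x \<le> 1 + x\<^sup>2" using that by (simp add: power2_diff)
      then have "(b + 1) * x \<le> \<bar>b + 1\<bar> * (1 + x\<^sup>2)"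
        using that by (intro mult_mono) auto
      moreover have "a * x\<^sup>2 \<le> \<bar>a\<bar> * x\<^sup>2" by (intro mult_right_mono) auto
      moreover have "0 \<le> (x\<^sup>2 / 2 - c)\<^sup>2" by simp
      then have "c * x\<^sup>2 \<le> x ^ 4 / 4 + c\<^sup>2"
        by (simp add: power2_diff power_divide flip: power_mult) (simp add: algebra_simps)
      ultimately show ?thesis by (simp add: c_def algebra_simps)
    qed
    then have "x powr (- 1 / 2) * exp (a * x\<^sup>2 + b * x - x ^ 4 / 4)
        \<le> x powr (- 1 / 2) * exp (c\<^sup>2 + \<bar>b + 1\<bar> - x)" if "x > 0" for x
      using that by (intro mult_left_mono) auto
    then show "AE x in lborel. x \<in> {0<..} \<longrightarrow>
        norm (decay a b x) \<le> norm (exp (c\<^sup>2 + \<bar>b + 1\<bar>) * (x powr (- 1 / 2) / exp x))"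
      by (intro AE_I2) (simp add: decay_def exp_diff mult.commute)
  qed
qed

section \<open>Bounds on the Pearcey integrand along the diagonals\<close>

definition pearcey_integrand ::
    "real \<Rightarrow> real \<Rightarrow> real \<Rightarrow> real \<Rightarrow> complex \<Rightarrow> real \<Rightarrow> complex" where
  "pearcey_integrand s t \<xi> \<eta> z w =
       exp (z ^ 4 / 4 + complex_of_real s * z\<^sup>2 / 2 + \<i> * complex_of_real \<xi> * z) /
       exp ((complex_of_real w) ^ 4 / 4 + complex_of_real t * (complex_of_real w)\<^sup>2 / 2
            + \<i> * complex_of_real \<eta> * complex_of_real w) *
       (1 / (z - complex_of_real w))"

text \<open>
  The geometric mean makes the bound on \<open>1 / (z - w)\<close> a product of functions of \<open>z\<close> and \<open>w\<close>
  that are integrable at \<open>0\<close>.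
\<close>

lemma norm_diff_diagonal_ge:
  assumes "Re (z\<^sup>2) = 0"
  shows "cmod z * \<bar>w\<bar> \<le> 2 * (cmod (z - complex_of_real w))\<^sup>2"
proof -
  have "(Re z)\<^sup>2 = (Im z)\<^sup>2"
    using assms by (simp add: power2_eq_square)
  then have r: "(cmod z)\<^sup>2 = 2 * (Re z)\<^sup>2"
    by (simp add: cmod_power2)
  have "(cmod (z - complex_of_real w))\<^sup>2 = (cmod z)\<^sup>2 - 2 * (w * Re z) + w\<^sup>2"
    by (simp add: cmod_power2 power2_diff)
  \<comment> \<open>By the second square, it is enough that \<open>4 * \<bar>Re z\<bar> *
    \<bar>w\<bar> \<le> 3 * (Re z)^2 + 3 / 2 * w^2\<close>. The first square times
    \<open>3 / 2\<close> gives this: the weight \<open>4 / 3\<close> matches the \<open>w^2\<close>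
    term exactly and leaves \<open>8 / 3 \<le> 3\<close> for the other.\<close>
  moreover have "0 \<le> (4 / 3 * \<bar>Re z\<bar> - \<bar>w\<bar>)\<^sup>2" "0 \<le> (cmod z - \<bar>w\<bar>)\<^sup>2" by simp_all
  then have "8 / 3 * (\<bar>Re z\<bar> * \<bar>w\<bar>) \<le> 16 / 9 * (Re z)\<^sup>2 + w\<^sup>2"
      "2 * (cmod z * \<bar>w\<bar>) \<le> (cmod z)\<^sup>2 + w\<^sup>2"
    by (simp_all add: power2_diff power_mult_distrib power_divide)
  moreover have "w * Re z \<le> \<bar>Re z\<bar> * \<bar>w\<bar>"
    by (metis abs_ge_self abs_mult mult.commute)
  ultimately show ?thesis using r zero_le_power2[of "Re z"] zero_le_power2[of w] by linarith
qed

text \<open>On the diagonals \<open>z^2\<close> is purely imaginary, so the \<open>s\<close> term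
  has modulus one and \<open>z^4 = - (cmod z)^4\<close>. The \<open>\<eta>\<close> term has modulus
  one because \<open>w\<close> is real.\<close>

lemma norm_pearcey_integrand_le:
  assumes z: "Re (z\<^sup>2) = 0" "z \<noteq> 0" and w: "w \<noteq> 0"
  shows "cmod (pearcey_integrand s t \<xi> \<eta> z w)
    \<le> 2 * (decay 0 \<bar>\<xi>\<bar> (cmod z) * decay (- t / 2) 0 \<bar>w\<bar>)"
proof -
  have "z\<^sup>2 = \<i> * of_real (Im (z\<^sup>2))"
    using z by (simp add: complex_eq_iff)
  then have "(z\<^sup>2)\<^sup>2 = - of_real ((Im (z\<^sup>2))\<^sup>2)"
    by (metis mult_minus1 of_real_power power_mult_distrib power2_i)
  moreover have "(Im (z\<^sup>2))\<^sup>2 = (cmod (z\<^sup>2))\<^sup>2"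
    using z by (simp only: cmod_power2) simp
  ultimately have z4: "z ^ 4 = - of_real (cmod z ^ 4)"
    by (simp add: norm_power flip: power_mult)
  have "- (\<xi> * Im z) \<le> \<bar>\<xi>\<bar> * cmod z"
    by (metis abs_Im_le_cmod abs_ge_minus_self abs_mult abs_ge_zero mult_left_mono order_trans)
  then have e1: "cmod (exp (z ^ 4 / 4 + complex_of_real s * z\<^sup>2 / 2 + \<i> * complex_of_real \<xi> * z))
      \<le> exp (\<bar>\<xi>\<bar> * cmod z - cmod z ^ 4 / 4)"
    using z(1) unfolding z4 by (simp add: norm_exp_eq_Re)
  have e2: "cmod (exp ((complex_of_real w) ^ 4 / 4 + complex_of_real t * (complex_of_real w)\<^sup>2 / 2
            + \<i> * complex_of_real \<eta> * complex_of_real w)) = exp (w ^ 4 / 4 + t * w\<^sup>2 / 2)"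
    by (simp add: norm_exp_eq_Re flip: of_real_power)
  have zw: "cmod (z - of_real w) > 0"
  proof -
    have "0 < cmod z * \<bar>w\<bar>" using z w by simp
    also note norm_diff_diagonal_ge[OF z(1)]
    finally show ?thesis by auto
  qed
  \<comment> \<open>Weakening the factor \<open>2\<close> to \<open>2^2\<close> makes its square
    root rational.\<close>
  have "sqrt (cmod z * \<bar>w\<bar>) \<le> sqrt (2\<^sup>2 * (cmod (z - of_real w))\<^sup>2)"
    by (intro real_sqrt_le_mono order_trans[OF norm_diff_diagonal_ge[OF z(1)]] mult_right_mono) simp_all
  then have "sqrt (cmod z) * sqrt \<bar>w\<bar> \<le> 2 * cmod (z - of_real w)"
    by (simp add: real_sqrt_mult)
  then have "1 / cmod (z - of_real w) \<le> 2 * (1 / (sqrt (cmod z) * sqrt \<bar>w\<bar>))"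
    using zw z w by (simp add: field_simps)
  also have "1 / (sqrt (cmod z) * sqrt \<bar>w\<bar>) = cmod z powr (- 1 / 2) * \<bar>w\<bar> powr (- 1 / 2)"
    by (simp add: powr_minus_divide powr_half_sqrt)
  finally have e3: "cmod (1 / (z - of_real w)) \<le> 2 * (cmod z powr (- 1 / 2) * \<bar>w\<bar> powr (- 1 / 2))"
    by (simp add: norm_divide)
  have "cmod (pearcey_integrand s t \<xi> \<eta> z w)
    \<le> exp (\<bar>\<xi>\<bar> * cmod z - cmod z ^ 4 / 4) / exp (w ^ 4 / 4 + t * w\<^sup>2 / 2)
      * (2 * (cmod z powr (- 1 / 2) * \<bar>w\<bar> powr (- 1 / 2)))"
    unfolding pearcey_integrand_def norm_mult norm_divide[of "exp _"] e2
    by (intro mult_mono divide_right_mono e1 e3) auto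
  also have "\<dots> = 2 * (decay 0 \<bar>\<xi>\<bar> (cmod z) * decay (- t / 2) 0 \<bar>w\<bar>)"
  proof -
    have "exp (- t / 2 * w\<^sup>2 + 0 * \<bar>w\<bar> - w ^ 4 / 4) = exp (- (w ^ 4 / 4 + t * w\<^sup>2 / 2))"
      by (rule arg_cong[where f = exp]) simp
    then have "decay (- t / 2) 0 \<bar>w\<bar> = \<bar>w\<bar> powr (- 1 / 2) / exp (w ^ 4 / 4 + t * w\<^sup>2 / 2)"
      unfolding decay_def power_even_abs_numeral[OF even_numeral] by (simp only: exp_minus divide_inverse)
    then show ?thesis
      by (simp add: decay_def)
  qed
  finally show ?thesis .
qed

lemma integrable_pearcey_integrand:
  assumes z: "Re (z\<^sup>2) = 0" "z \<noteq> 0"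
  shows "set_integrable lborel {0<..} (pearcey_integrand s t \<xi> \<eta> z)"
    and "set_integrable lborel {0<..} (\<lambda>w. pearcey_integrand s t \<xi> \<eta> z (- w))"
proof -
  have meas: "set_borel_measurable lborel {0<..} (pearcey_integrand s t \<xi> \<eta> z)"
    "set_borel_measurable lborel {0<..} (\<lambda>w. pearcey_integrand s t \<xi> \<eta> z (- w))"
    unfolding pearcey_integrand_def set_borel_measurable_def by measurable
  have int: "set_integrable lborel {0<..}
      (\<lambda>w. 2 * (decay 0 \<bar>\<xi>\<bar> (cmod z) * decay (- t / 2) 0 w))"
    by (intro set_integrable_mult_right integrable_decay)
  have le: "norm (pearcey_integrand s t \<xi> \<eta> z w)
      \<le> norm (2 * (decay 0 \<bar>\<xi>\<bar> (cmod z) * decay (- t / 2) 0 \<bar>w\<bar>))" if "w \<noteq> 0" for w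
    using norm_pearcey_integrand_le[OF z that] by (rule order_trans) (simp only: real_norm_def abs_ge_self)
  show "set_integrable lborel {0<..} (pearcey_integrand s t \<xi> \<eta> z)"
  proof (rule set_integrable_bound[OF int meas(1)], intro AE_I2 impI)
    fix w :: real assume "w \<in> {0<..}"
    then show "norm (pearcey_integrand s t \<xi> \<eta> z w)
      \<le> norm (2 * (decay 0 \<bar>\<xi>\<bar> (cmod z) * decay (- t / 2) 0 w))"
      using le[of w] by simp
  qed
  show "set_integrable lborel {0<..} (\<lambda>w. pearcey_integrand s t \<xi> \<eta> z (- w))"
  proof (rule set_integrable_bound[OF int meas(2)], intro AE_I2 impI)
    fix w :: real assume "w \<in> {0<..}"
    then show "norm (pearcey_integrand s t \<xi> \<eta> z (- w))
      \<le> norm (2 * (decay 0 \<bar>\<xi>\<bar> (cmod z) * decay (- t / 2) 0 w))"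
      using le[of "- w"] by simp
  qed
qed

section \<open>Folding the inner integral at the origin\<close>

lemma lborel_integral_fold:
  fixes f :: "real \<Rightarrow> 'a :: {banach, second_countable_topology}"
  assumes "set_integrable lborel {0<..} f" "set_integrable lborel {0<..} (\<lambda>x. f (- x))"
  shows "(LBINT x. f x) = (LBINT x:{0<..}. f x + f (- x))"
proof -
  have *: "(\<lambda>x. indicator {0<..} x *\<^sub>R f (- x)) = (\<lambda>x. indicator {..<0} (- x) *\<^sub>R f (- x))"
    by (auto simp: indicator_def)
  have neg: "set_integrable lborel {..<0} f"
    using assms(2) lborel_integrable_real_affine_iff[of "-1" "\<lambda>x. indicator {..<0} x *\<^sub>R f x" 0]
    unfolding set_integrable_def * by simp
  have eq: "(LBINT x:{..<0}. f x) = (LBINT x:{0<..}. f (- x))"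
    by (subst set_integral_reflect) (simp add: greaterThan_def)
  have "(LBINT x. f x) = (LBINT x:UNIV - {0}. f x)"
    unfolding set_lebesgue_integral_def
    by (rule integral_discrete_difference[where X = "{0}"]) auto
  also have "UNIV - {0} = {0<..} \<union> {..<0::real}" by auto
  also have "(LBINT x:\<dots>. f x) = (LBINT x:{0<..}. f x) + (LBINT x:{..<0}. f x)"
    by (intro set_integral_Un assms neg) auto
  finally show ?thesis using assms by (simp add: eq)
qed


lemma pearcey_inner_integral_fold:
  assumes "Re (z\<^sup>2) = 0" "z \<noteq> 0"
  shows "(LBINT w. pearcey_integrand s t \<xi> \<eta> z w)
    = (LBINT w:{0<..}. pearcey_integrand s t \<xi> \<eta> z w + pearcey_integrand s t \<xi> \<eta> z (- w))"
  by (intro lborel_integral_fold integrable_pearcey_integrand assms)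

text \<open>The pointwise majorant is a product, so the \<open>w\<close>-integral separates off as a
  constant. The factor \<open>4\<close> is the pointwise \<open>2\<close> counted on both
  half-lines.\<close>

lemma norm_pearcey_inner_integral_le:
  assumes z: "Re (z\<^sup>2) = 0" "z \<noteq> 0"
  shows "cmod (LBINT w. pearcey_integrand s t \<xi> \<eta> z w)
    \<le> decay 0 \<bar>\<xi>\<bar> (cmod z) * (4 * (LBINT w:{0<..}. decay (- t / 2) 0 w))"
proof -
  let ?f = "pearcey_integrand s t \<xi> \<eta> z"
  let ?d = "\<lambda>w. 4 * (decay 0 \<bar>\<xi>\<bar> (cmod z) * decay (- t / 2) 0 w)"
  have "cmod (LBINT w. ?f w) \<le> (LBINT w:{0<..}. ?d w)"
    unfolding pearcey_inner_integral_fold[OF z] set_lebesgue_integral_def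
  proof (rule Bochner_Integration.integral_norm_bound_integral)
    have "set_integrable lborel {0<..} (\<lambda>w. ?f w + ?f (- w))"
      by (intro set_integral_add integrable_pearcey_integrand z)
    then show "integrable lborel (\<lambda>w. indicator {0<..} w *\<^sub>R (?f w + ?f (- w)))"
      by (simp add: set_integrable_def)
    have "set_integrable lborel {0<..} ?d"
      by (intro set_integrable_mult_right integrable_decay)
    then show "integrable lborel (\<lambda>w. indicator {0<..} w *\<^sub>R ?d w)"
      by (simp add: set_integrable_def)
    fix w :: real
    show "norm (indicator {0<..} w *\<^sub>R (?f w + ?f (- w))) \<le> indicator {0<..} w *\<^sub>R ?d w"
    proof (cases "w > 0")
      case True
      then have "cmod (?f w) \<le> ?d w / 2" "cmod (?f (- w)) \<le> ?d w / 2"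
        using norm_pearcey_integrand_le[OF z, of w s t \<xi> \<eta>]
          norm_pearcey_integrand_le[OF z, of "- w" s t \<xi> \<eta>] by simp_all
      then have "cmod (?f w + ?f (- w)) \<le> ?d w"
        using norm_triangle_ineq[of "?f w" "?f (- w)"] by linarith
      then show ?thesis using True by simp
    qed simp
  qed
  then show ?thesis by (simp add: mult_ac)
qed

section \<open>Folding the contours\<close>

text \<open>The direction factor \<open>cis \<theta>\<close> is constant along a ray, so
  integrability is stated for \<open>f\<close> alone.\<close>

definition ray_integrable :: "real \<Rightarrow> (complex \<Rightarrow> complex) \<Rightarrow> bool" where
  "ray_integrable \<theta> f \<longleftrightarrow> set_integrable lborel {0<..} (\<lambda>r. f (complex_of_real r * cis \<theta>))"

text \<open>The condition \<open>cos (2 * \<theta>) = 0\<close> describes all four directions of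
  \<open>X\<close> at once.\<close>

lemma Re_diagonal_square: "cos (2 * \<theta>) = 0 \<Longrightarrow> Re ((complex_of_real r * cis \<theta>)\<^sup>2) = 0"
  by (simp add: power_mult_distrib Complex.DeMoivre flip: of_real_power)

text \<open>The bound on the inner integral is a constant multiple of
  \<open>decay 0 \<bar>\<xi>\<bar>\<close> in the modulus, hence integrable at \<open>0\<close> and
  at infinity.\<close>

lemma ray_integrable_pearcey:
  assumes "cos (2 * \<theta>) = 0"
  shows "ray_integrable \<theta> (\<lambda>z. LBINT w. pearcey_integrand s t \<xi> \<eta> z w)"
  unfolding ray_integrable_def
proof (rule set_integrable_bound)
  show "set_integrable lborel {0<..}
      (\<lambda>r. decay 0 \<bar>\<xi>\<bar> r * (4 * (LBINT w:{0<..}. decay (- t / 2) 0 w)))"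
    by (intro set_integrable_mult_left integrable_decay)
  show "set_borel_measurable lborel {0<..}
      (\<lambda>r. LBINT w. pearcey_integrand s t \<xi> \<eta> (complex_of_real r * cis \<theta>) w)"
    unfolding set_borel_measurable_def pearcey_integrand_def by measurable
  show "AE r in lborel. r \<in> {0<..} \<longrightarrow>
     norm (LBINT w. pearcey_integrand s t \<xi> \<eta> (complex_of_real r * cis \<theta>) w)
     \<le> norm (decay 0 \<bar>\<xi>\<bar> r * (4 * (LBINT w:{0<..}. decay (- t / 2) 0 w)))"
  proof (intro AE_I2 impI)
    fix r :: real assume "r \<in> {0<..}"
    then have "norm (LBINT w. pearcey_integrand s t \<xi> \<eta> (complex_of_real r * cis \<theta>) w)
     \<le> decay 0 \<bar>\<xi>\<bar> r * (4 * (LBINT w:{0<..}. decay (- t / 2) 0 w))"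
      using norm_pearcey_inner_integral_le[OF Re_diagonal_square[OF assms, of r]]
      by (simp add: norm_mult)
    then show "norm (LBINT w. pearcey_integrand s t \<xi> \<eta> (complex_of_real r * cis \<theta>) w)
     \<le> norm (decay 0 \<bar>\<xi>\<bar> r * (4 * (LBINT w:{0<..}. decay (- t / 2) 0 w)))"
      by (rule order_trans) (simp only: real_norm_def abs_ge_self)
  qed
qed

lemma ray_integral_add:
  assumes "ray_integrable \<theta> f" "ray_integrable \<theta> g"
  shows "ray_integral \<theta> (\<lambda>z. f z + g z) = ray_integral \<theta> f + ray_integral \<theta> g"
  using assms unfolding ray_integrable_def ray_integral_def
  by (simp add: distrib_right)

lemma ray_integral_cmult: "ray_integral \<theta> (\<lambda>z. c * f z) = c * ray_integral \<theta> f"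
  unfolding ray_integral_def by (simp add: mult.assoc)

lemma ray_integrable_cmult: "ray_integrable \<theta> f \<Longrightarrow> ray_integrable \<theta> (\<lambda>z. c * f z)"
  unfolding ray_integrable_def by simp

lemma ray_integrable_add:
  "ray_integrable \<theta> f \<Longrightarrow> ray_integrable \<theta> g \<Longrightarrow> ray_integrable \<theta> (\<lambda>z. f z + g z)"
  unfolding ray_integrable_def by simp

lemma ray_integral_opposite:
  assumes "cis \<theta>' = - cis \<theta>"
  shows "ray_integral \<theta>' f = - ray_integral \<theta> (\<lambda>z. f (- z))"
proof -
  have "(\<lambda>r. f (complex_of_real r * cis \<theta>') * cis \<theta>')
      = (\<lambda>r. - 1 * (f (- (complex_of_real r * cis \<theta>)) * cis \<theta>))"
    by (simp add: assms)
  then show ?thesis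
    unfolding ray_integral_def by (simp only: set_integral_mult_right) simp
qed

lemma cis_diagonal:
  "cis (5 * pi / 4) = - cis (pi / 4)" "cis (3 * pi / 4) = - cis (- pi / 4)"
  "cis (7 * pi / 4) = cis (- pi / 4)"
proof -
  have "5 * pi / 4 = pi / 4 + pi" "3 * pi / 4 = - pi / 4 + pi" "7 * pi / 4 = - pi / 4 + 2 * pi"
    by simp_all
  then show "cis (5 * pi / 4) = - cis (pi / 4)" "cis (3 * pi / 4) = - cis (- pi / 4)"
    "cis (7 * pi / 4) = cis (- pi / 4)"
    by (simp_all only: cis_mult[symmetric]) simp_all
qed

text \<open>The rays at \<open>5 * pi / 4\<close> and \<open>3 * pi / 4\<close> are the images of
  those of \<open>C\<close> under \<open>z \<mapsto> - z\<close>. The sign of \<open>dz\<close>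
  changes under this map, which yields a difference and keeps only the odd part of
  \<open>f\<close>.\<close>

lemma X_integral_fold:
  assumes "\<And>\<theta>. cos (2 * \<theta>) = 0 \<Longrightarrow> ray_integrable \<theta> f"
  shows "X_integral f = C_integral (\<lambda>z. f z - f (- z))"
proof -
  have 1: "ray_integral (5 * pi / 4) f = - ray_integral (pi / 4) (\<lambda>z. f (- z))"
    "ray_integral (3 * pi / 4) f = - ray_integral (- pi / 4) (\<lambda>z. f (- z))"
    by (intro ray_integral_opposite cis_diagonal)+
  have 2: "ray_integral (7 * pi / 4) f = ray_integral (- pi / 4) f"
    by (simp only: ray_integral_def cis_diagonal)
  have 3: "ray_integral \<theta> (\<lambda>z. f z - f (- z)) = ray_integral \<theta> f - ray_integral \<theta> (\<lambda>z. f (- z))"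
    if "cos (2 * \<theta>) = 0" for \<theta>
  proof -
    \<comment> \<open>Integrability in the direction \<open>\<theta> + pi\<close>, again a diagonal,
      is integrability of \<open>f (- z)\<close> along \<open>\<theta>\<close>.\<close>
    have "ray_integrable \<theta> f" "ray_integrable (\<theta> + pi) f"
      using that by (intro assms; simp add: distrib_left)+
    moreover have "cis (\<theta> + pi) = - cis \<theta>"
      by (simp flip: cis_mult)
    ultimately show ?thesis
      unfolding ray_integrable_def ray_integral_def by (simp add: left_diff_distrib)
  qed
  show ?thesis
    unfolding X_integral_def C_integral_def by (subst (1 2) 3) (simp_all add: 1 2)
qed

text \<open>Agreement is asked only on the open right half-plane diagonals, where
  \<open>z + w\<close> and \<open>z - w\<close> are nonzero for real \<open>w\<close> and the
  principal logarithms split.\<close>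

lemma C_integral_cong:
  assumes "\<And>z. Re z > 0 \<Longrightarrow> Re (z\<^sup>2) = 0 \<Longrightarrow> f z = g z"
  shows "C_integral f = C_integral g"
proof -
  have "ray_integral \<theta> f = ray_integral \<theta> g" if "cos \<theta> > 0" "cos (2 * \<theta>) = 0" for \<theta>
    unfolding ray_integral_def
    by (rule set_lebesgue_integral_cong)
      (use that assms Re_diagonal_square in \<open>auto\<close>)
  from this[of "pi / 4"] this[of "- pi / 4"] show ?thesis
    unfolding C_integral_def by (simp add: cos_45)
qed

section \<open>Even and odd Pearcey kernels as double integrals over \<open>C\<close> and the
  half-line\<close>

definition pearcey_weight :: "real \<Rightarrow> real \<Rightarrow> complex \<Rightarrow> complex \<Rightarrow> complex" where
  "pearcey_weight s t z w =
     exp (z ^ 4 / 4 + complex_of_real s * z\<^sup>2 / 2) / exp (w ^ 4 / 4 + complex_of_real t * w\<^sup>2 / 2)"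

lemma pearcey_tilde_eq_X_integral:
  "pearcey_tilde s t \<xi> \<eta> =
     \<i> / (2 * complex_of_real pi * \<i>)\<^sup>2 * X_integral (\<lambda>z. LBINT w. pearcey_integrand s t \<xi> \<eta> z w)"
  unfolding pearcey_tilde_def pearcey_integrand_def ..

lemma X_integral_linear:
  assumes "\<And>\<theta>. cos (2 * \<theta>) = 0 \<Longrightarrow> ray_integrable \<theta> f"
    and "\<And>\<theta>. cos (2 * \<theta>) = 0 \<Longrightarrow> ray_integrable \<theta> g"
  shows "X_integral (\<lambda>z. f z + c * g z) = X_integral f + c * X_integral g"
proof -
  have eq: "ray_integral \<theta> (\<lambda>z. f z + c * g z) = ray_integral \<theta> f + c * ray_integral \<theta> g"
    if "cos (2 * \<theta>) = 0" for \<theta>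
    using that by (simp add: assms ray_integral_add ray_integrable_cmult ray_integral_cmult)
  have "5 * pi / 2 = pi / 2 + 2 * pi" "3 * pi / 2 = pi / 2 + pi"
    "7 * pi / 2 = pi / 2 + 3 * pi"
    by simp_all
  then have "cos (5 * pi / 2) = 0" "cos (3 * pi / 2) = 0" "cos (7 * pi / 2) = 0"
    by (simp_all only: cos_add) simp_all
  then show ?thesis
    unfolding X_integral_def by (subst (1 2 3 4) eq) (simp_all add: algebra_simps)
qed

text \<open>The cases \<open>\<sigma> = 1\<close> and \<open>\<sigma> = - 1\<close> give the even
  and odd kernels. The eight terms are the sign changes of \<open>\<eta>\<close>, \<open>z\<close>
  and \<open>w\<close>.\<close>

lemma pearcey_tilde_fold:
  fixes \<sigma> :: complex
  shows "pearcey_tilde s t \<xi> \<eta> + \<sigma> * pearcey_tilde s t \<xi> (- \<eta>) =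
    \<i> / (2 * complex_of_real pi * \<i>)\<^sup>2 * C_integral (\<lambda>z. LBINT w:{0<..}.
      pearcey_integrand s t \<xi> \<eta> z w + pearcey_integrand s t \<xi> \<eta> z (- w)
      + \<sigma> * (pearcey_integrand s t \<xi> (- \<eta>) z w + pearcey_integrand s t \<xi> (- \<eta>) z (- w))
      - (pearcey_integrand s t \<xi> \<eta> (- z) w + pearcey_integrand s t \<xi> \<eta> (- z) (- w)
      + \<sigma> * (pearcey_integrand s t \<xi> (- \<eta>) (- z) w + pearcey_integrand s t \<xi> (- \<eta>) (- z) (- w))))"
    (is "_ = ?k * C_integral ?F")
proof -
  define P where "P \<eta> z = (LBINT w. pearcey_integrand s t \<xi> \<eta> z w)" for \<eta> z
  have P: "ray_integrable \<theta> (P \<eta>)" if "cos (2 * \<theta>) = 0" for \<theta> \<eta>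
    unfolding P_def by (rule ray_integrable_pearcey[OF that])
  have "pearcey_tilde s t \<xi> \<eta> + \<sigma> * pearcey_tilde s t \<xi> (- \<eta>)
      = ?k * (X_integral (P \<eta>) + \<sigma> * X_integral (P (- \<eta>)))"
    unfolding pearcey_tilde_eq_X_integral P_def by (simp only: distrib_left mult.left_commute)
  also have "X_integral (P \<eta>) + \<sigma> * X_integral (P (- \<eta>))
      = X_integral (\<lambda>z. P \<eta> z + \<sigma> * P (- \<eta>) z)"
    by (simp add: X_integral_linear P)
  also have "\<dots> = C_integral (\<lambda>z. P \<eta> z + \<sigma> * P (- \<eta>) z - (P \<eta> (- z) + \<sigma> * P (- \<eta>) (- z)))"
    by (intro X_integral_fold ray_integrable_add ray_integrable_cmult P)
  also have "\<dots> = C_integral ?F"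
  proof (rule C_integral_cong)
    fix z assume "Re z > 0" "Re (z\<^sup>2) = 0"
    then have "Re (z\<^sup>2) = 0" "z \<noteq> 0" "Re ((- z)\<^sup>2) = 0" "- z \<noteq> 0" by auto
    note z = this
    note int = integrable_pearcey_integrand[OF z(1,2)] integrable_pearcey_integrand[OF z(3,4)]
    show "P \<eta> z + \<sigma> * P (- \<eta>) z - (P \<eta> (- z) + \<sigma> * P (- \<eta>) (- z)) = ?F z"
      unfolding P_def pearcey_inner_integral_fold[OF z(1,2)] pearcey_inner_integral_fold[OF z(3,4)]
      by (simp add: int set_integral_add set_integral_diff)
  qed
  finally show ?thesis .
qed

text \<open>The weight is even in both variables, so the reflections act only on the three remaining
  factors.\<close>

lemma pearcey_integrand_eq_weight:
  "pearcey_integrand s t \<xi> \<eta> z w = pearcey_weight s t z (of_real w) *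
     exp (\<i> * of_real \<xi> * z) * exp (- (\<i> * of_real \<eta> * of_real w)) * (1 / (z - of_real w))"
  unfolding pearcey_integrand_def pearcey_weight_def
  by (simp only: exp_add exp_minus divide_inverse inverse_mult_distrib mult_ac)

lemma pearcey_weight_minus [simp]:
  "pearcey_weight s t (- z) w = pearcey_weight s t z w"
  "pearcey_weight s t z (- w) = pearcey_weight s t z w"
  by (simp_all add: pearcey_weight_def)

text \<open>The eight terms factor as \<open>E\<close> times a sum of two poles and two sums of
  exponentials in the even case, and differences of the same in the odd case. Each of the three
  factors contributes a \<open>2\<close> to the constant \<open>8\<close>; in the odd case the two
  factors \<open>1 / \<i>\<close> from the sines account for the minus sign.\<close>

lemma
  assumes "z + of_real w \<noteq> 0" "z - of_real w \<noteq> 0"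
  shows pearcey_integrand_even_sum:
    "pearcey_integrand s t \<xi> \<eta> z w + pearcey_integrand s t \<xi> \<eta> z (- w)
      + 1 * (pearcey_integrand s t \<xi> (- \<eta>) z w + pearcey_integrand s t \<xi> (- \<eta>) z (- w))
      - (pearcey_integrand s t \<xi> \<eta> (- z) w + pearcey_integrand s t \<xi> \<eta> (- z) (- w)
      + 1 * (pearcey_integrand s t \<xi> (- \<eta>) (- z) w + pearcey_integrand s t \<xi> (- \<eta>) (- z) (- w)))
    = 8 * (z / (z\<^sup>2 - (of_real w)\<^sup>2) * pearcey_weight s t z (of_real w)
        * cos (of_real \<eta> * of_real w) * cos (of_real \<xi> * z))" (is "?lhs_even = ?rhs_even")
    and pearcey_integrand_odd_sum:
    "pearcey_integrand s t \<xi> \<eta> z w + pearcey_integrand s t \<xi> \<eta> z (- w)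
      + (- 1) * (pearcey_integrand s t \<xi> (- \<eta>) z w + pearcey_integrand s t \<xi> (- \<eta>) z (- w))
      - (pearcey_integrand s t \<xi> \<eta> (- z) w + pearcey_integrand s t \<xi> \<eta> (- z) (- w)
      + (- 1) * (pearcey_integrand s t \<xi> (- \<eta>) (- z) w + pearcey_integrand s t \<xi> (- \<eta>) (- z) (- w)))
    = 8 * (of_real w / (z\<^sup>2 - (of_real w)\<^sup>2) * pearcey_weight s t z (of_real w)
        * sin (of_real \<eta> * of_real w) * sin (of_real \<xi> * z))" (is "?lhs_odd = ?rhs_odd")
proof -
  define E where "E = pearcey_weight s t z (of_real w)"
  define a where "a = exp (\<i> * of_real \<xi> * z)"
  define b where "b = exp (\<i> * of_real \<eta> * of_real w)"
  define p where "p = 1 / (z - of_real w)"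
  define q where "q = 1 / (z + of_real w)"
  define a' where "a' = exp (- (\<i> * of_real \<xi> * z))"
  define b' where "b' = exp (- (\<i> * of_real \<eta> * of_real w))"
  \<comment> \<open>Negating \<open>z\<close> exchanges the two poles up to sign.\<close>
  have p': "1 / (- z + of_real w) = - p" and q': "1 / (- z - of_real w) = - q"
    unfolding p_def q_def by (simp_all only: minus_divide_right) simp_all
  have nz: "z\<^sup>2 - (of_real w)\<^sup>2 \<noteq> 0"
    using assms by (simp add: power2_eq_square square_diff_square_factored)
  have pq: "z / (z\<^sup>2 - (of_real w)\<^sup>2) = (p + q) / 2" "of_real w / (z\<^sup>2 - (of_real w)\<^sup>2) = (p - q) / 2"
    using nz assms unfolding p_def q_def
    by (simp_all add: divide_simps) (simp_all add: power2_eq_square algebra_simps)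
  have trig: "cos (of_real \<eta> * of_real w) = (b + b') / 2" "cos (of_real \<xi> * z) = (a + a') / 2"
     "sin (of_real \<eta> * of_real w) = (b - b') / (2 * \<i>)" "sin (of_real \<xi> * z) = (a - a') / (2 * \<i>)"
    unfolding a_def b_def a'_def b'_def by (simp_all add: cos_exp_eq sin_exp_eq mult.assoc)
  have I: "pearcey_integrand s t \<xi> \<eta> z w = E * a * b' * p"
     "pearcey_integrand s t \<xi> \<eta> z (- w) = E * a * b * q"
     "pearcey_integrand s t \<xi> (- \<eta>) z w = E * a * b * p"
     "pearcey_integrand s t \<xi> (- \<eta>) z (- w) = E * a * b' * q"
     "pearcey_integrand s t \<xi> \<eta> (- z) w = E * a' * b' * (- q)"
     "pearcey_integrand s t \<xi> \<eta> (- z) (- w) = E * a' * b * (- p)"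
     "pearcey_integrand s t \<xi> (- \<eta>) (- z) w = E * a' * b * (- q)"
     "pearcey_integrand s t \<xi> (- \<eta>) (- z) (- w) = E * a' * b' * (- p)"
    unfolding pearcey_integrand_eq_weight E_def a_def b_def a'_def b'_def p'[symmetric] q'[symmetric]
    by (simp_all add: p_def q_def)
  have "?lhs_even = E * (b + b') * (a + a') * (p + q)"
    unfolding I by (simp add: algebra_simps)
  also have "\<dots> = 8 * ((p + q) / 2 * E * ((b + b') / 2) * ((a + a') / 2))"
    by simp
  finally show "?lhs_even = ?rhs_even"
    unfolding pq trig E_def .
  have "?lhs_odd = - (E * (b - b') * (a - a') * (p - q))"
    unfolding I by (simp add: algebra_simps)
  also have "\<dots> = 8 * ((p - q) / 2 * E * ((b - b') / (2 * \<i>)) * ((a - a') / (2 * \<i>)))"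
    by (simp add: mult_ac)
  finally show "?lhs_odd = ?rhs_odd"
    unfolding pq trig E_def .
qed

lemma diagonal_diff_real_nonzero:
  assumes "Re z > 0" "Re (z\<^sup>2) = 0"
  shows "z + of_real w \<noteq> 0" "z - of_real w \<noteq> 0"
  using assms by (auto simp: complex_eq_iff power2_eq_square)

lemma C_integral_cmult: "C_integral (\<lambda>z. c * f z) = c * C_integral f"
  unfolding C_integral_def ray_integral_cmult by (simp add: algebra_simps)

text \<open>The meeting point of the two sides: the even Pearcey integral and the rescaled hard-edge
  integral of order \<open>- 1 / 2\<close> are both \<open>2 / (pi^2 * \<i>)\<close> times this. The
  odd integral below plays the same role for order \<open>1 / 2\<close>.\<close>

definition even_double_integral :: "real \<Rightarrow> real \<Rightarrow> real \<Rightarrow> real \<Rightarrow> complex" where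
  "even_double_integral s t \<xi> \<eta> = C_integral (\<lambda>z. LBINT w:{0<..}.
     z / (z\<^sup>2 - (of_real w)\<^sup>2) * pearcey_weight s t z (of_real w)
        * cos (of_real \<eta> * of_real w) * cos (of_real \<xi> * z))"

definition odd_double_integral :: "real \<Rightarrow> real \<Rightarrow> real \<Rightarrow> real \<Rightarrow> complex" where
  "odd_double_integral s t \<xi> \<eta> = C_integral (\<lambda>z. LBINT w:{0<..}.
     of_real w / (z\<^sup>2 - (of_real w)\<^sup>2) * pearcey_weight s t z (of_real w)
        * sin (of_real \<eta> * of_real w) * sin (of_real \<xi> * z))"

lemma pearcey_constant: "\<i> / (2 * complex_of_real pi * \<i>)\<^sup>2 * 8 = 2 / (of_real pi ^ 2 * \<i>)"
  by (simp add: power_mult_distrib divide_simps)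

lemma pearcey_tilde_even:
  "pearcey_tilde s t \<xi> \<eta> + pearcey_tilde s t \<xi> (- \<eta>) =
     2 / (of_real pi ^ 2 * \<i>) * even_double_integral s t \<xi> \<eta>"
proof -
  \<comment> \<open>The factor \<open>1\<close> makes the left side an instance of
    \<open>pearcey_tilde_fold\<close>.\<close>
  have "pearcey_tilde s t \<xi> \<eta> + 1 * pearcey_tilde s t \<xi> (- \<eta>) =
     \<i> / (2 * complex_of_real pi * \<i>)\<^sup>2 * (8 * even_double_integral s t \<xi> \<eta>)"
    unfolding pearcey_tilde_fold even_double_integral_def C_integral_cmult[symmetric]
      set_integral_mult_right[symmetric]
    by (intro arg_cong[where f = "\<lambda>x. _ * x"] C_integral_cong set_lebesgue_integral_cong allI impI
        pearcey_integrand_even_sum diagonal_diff_real_nonzero) auto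
  then show ?thesis unfolding mult.assoc[symmetric] pearcey_constant by simp
qed

lemma pearcey_tilde_odd:
  "pearcey_tilde s t \<xi> \<eta> - pearcey_tilde s t \<xi> (- \<eta>) =
     2 / (of_real pi ^ 2 * \<i>) * odd_double_integral s t \<xi> \<eta>"
proof -
  have "pearcey_tilde s t \<xi> \<eta> + (- 1) * pearcey_tilde s t \<xi> (- \<eta>) =
     \<i> / (2 * complex_of_real pi * \<i>)\<^sup>2 * (8 * odd_double_integral s t \<xi> \<eta>)"
    unfolding pearcey_tilde_fold odd_double_integral_def C_integral_cmult[symmetric]
      set_integral_mult_right[symmetric]
    by (intro arg_cong[where f = "\<lambda>x. _ * x"] C_integral_cong set_lebesgue_integral_cong allI impI
        pearcey_integrand_odd_sum diagonal_diff_real_nonzero) auto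
  then show ?thesis unfolding mult.assoc[symmetric] pearcey_constant by simp
qed

section \<open>Bessel functions of order plus or minus one half\<close>

lemma cos_even_sums: "(\<lambda>k. (- 1) ^ k / fact (2 * k) * z ^ (2 * k)) sums cos (z :: complex)"
proof -
  have "(\<lambda>k. cos_coeff (2 * k) *\<^sub>R z ^ (2 * k)) sums cos z"
    using cos_converges[of z]
    by (subst sums_mono_reindex[of "\<lambda>k. 2 * k" "\<lambda>n. cos_coeff n *\<^sub>R z ^ n"])
      (auto simp: strict_mono_def cos_coeff_def)
  then show ?thesis
    by (simp add: cos_coeff_def scaleR_conv_of_real)
qed

lemma sin_odd_sums: "(\<lambda>k. (- 1) ^ k / fact (2 * k + 1) * z ^ (2 * k + 1)) sums sin (z :: complex)"
proof -
  have "(\<lambda>k. sin_coeff (2 * k + 1) *\<^sub>R z ^ (2 * k + 1)) sums sin z"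
    using sin_converges[of z]
    by (subst sums_mono_reindex[of "\<lambda>k. 2 * k + 1" "\<lambda>n. sin_coeff n *\<^sub>R z ^ n"])
      (auto simp: strict_mono_def sin_coeff_def elim!: oddE)
  then show ?thesis
    by (simp add: sin_coeff_def scaleR_conv_of_real)
qed

text \<open>Induction by the functional equation from \<open>Gamma (1 / 2) = sqrt pi\<close>. In the
  Bessel series \<open>4 ^ k\<close> cancels the halves in \<open>(z / 2) ^ (2 * k)\<close> and
  \<open>fact k\<close> cancels the factorial there, which leaves the cosine series.\<close>

lemma rGamma_nat_plus_half:
  "rGamma (of_nat k + 1 / 2 :: complex) = 4 ^ k * fact k / (fact (2 * k) * of_real (sqrt pi))"
proof (induction k)
  case 0
  then show ?case
    by (simp add: rGamma_inverse_Gamma Gamma_one_half_complex inverse_eq_divide)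
next
  case (Suc k)
  have nz: "of_nat k + 1 / 2 \<noteq> (0 :: complex)" "1 + of_nat k * 2 \<noteq> (0 :: complex)"
    "1 + 2 * of_nat k \<noteq> (0 :: complex)" "2 + of_nat k * 2 \<noteq> (0 :: complex)"
    "of_nat k + 1 \<noteq> (0 :: complex)"
    by (auto simp: complex_eq_iff)
  have "rGamma (of_nat (Suc k) + 1 / 2 :: complex) = rGamma (of_nat k + 1 / 2) / (of_nat k + 1 / 2)"
    using rGamma_plus1[of "of_nat k + 1 / 2 :: complex"] nz by (simp add: field_simps)
  also have "\<dots> = 4 ^ Suc k * fact (Suc k) / (fact (2 * Suc k) * of_real (sqrt pi))"
    unfolding Suc.IH using nz by (simp add: divide_simps) (simp add: algebra_simps)
  finally show ?case .
qed

lemma rGamma_nat_plus_three_halves: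
  "rGamma (of_nat k + 3 / 2 :: complex) =
     2 * 4 ^ k * fact k / (fact (2 * k + 1) * of_real (sqrt pi))"
proof -
  have nz: "of_nat k + 1 / 2 \<noteq> (0 :: complex)" "1 + of_nat k * 2 \<noteq> (0 :: complex)"
    "1 + 2 * of_nat k \<noteq> (0 :: complex)" "2 + of_nat k * 2 \<noteq> (0 :: complex)"
    by (auto simp: complex_eq_iff)
  have "rGamma (of_nat k + 3 / 2 :: complex) = rGamma (of_nat k + 1 / 2) / (of_nat k + 1 / 2)"
    using rGamma_plus1[of "of_nat k + 1 / 2 :: complex"] nz by (simp add: field_simps)
  also have "\<dots> = 2 * 4 ^ k * fact k / (fact (2 * k + 1) * of_real (sqrt pi))"
    unfolding rGamma_nat_plus_half using nz by (simp add: divide_simps)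
  finally show ?thesis .
qed

text \<open>The unsimplified \<open>real k + - 1 / 2 + 1\<close> is the form that unfolding the
  Bessel functions at order \<open>- 1 / 2\<close> produces.\<close>

lemma bessel_series_minus_half:
  "(\<Sum>k. (- 1) ^ k / fact k * rGamma (complex_of_real (real k + - 1 / 2 + 1)) * (z / 2) ^ (2 * k))
    = cos z / of_real (sqrt pi)"
proof (rule sums_unique[symmetric])
  have "complex_of_real (real k + - 1 / 2 + 1) = of_nat k + 1 / 2" for k
    by (simp add: complex_eq_iff)
  then have "(- 1) ^ k / fact k * rGamma (complex_of_real (real k + - 1 / 2 + 1)) * (z / 2) ^ (2 * k)
      = (- 1) ^ k / fact (2 * k) * z ^ (2 * k) / of_real (sqrt pi)" for k
    by (simp only: rGamma_nat_plus_half) (simp add: power_divide power_mult)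
  then show "(\<lambda>k. (- 1) ^ k / fact k * rGamma (complex_of_real (real k + - 1 / 2 + 1))
      * (z / 2) ^ (2 * k)) sums (cos z / of_real (sqrt pi))"
    using sums_divide[OF cos_even_sums[of z]] by simp
qed

lemma bessel_series_half:
  assumes "z \<noteq> 0"
  shows "(\<Sum>k. (- 1) ^ k / fact k * rGamma (complex_of_real (real k + 1 / 2 + 1)) * (z / 2) ^ (2 * k))
    = 2 / z * sin z / of_real (sqrt pi)"
proof (rule sums_unique[symmetric])
  have "complex_of_real (real k + 1 / 2 + 1) = of_nat k + 3 / 2" for k
    by (simp add: complex_eq_iff)
  then have "(- 1) ^ k / fact k * rGamma (complex_of_real (real k + 1 / 2 + 1)) * (z / 2) ^ (2 * k)
      = 2 / z * ((- 1) ^ k / fact (2 * k + 1) * z ^ (2 * k + 1)) / of_real (sqrt pi)" for k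
    using assms by (simp only: rGamma_nat_plus_three_halves) (simp add: power_divide power_mult del: fact_Suc)
  then show "(\<lambda>k. (- 1) ^ k / fact k * rGamma (complex_of_real (real k + 1 / 2 + 1))
      * (z / 2) ^ (2 * k)) sums (2 / z * sin z / of_real (sqrt pi))"
    using sums_divide[OF sums_mult[OF sin_odd_sums[of z], of "2 / z"]] by simp
qed

text \<open>The factor \<open>2 / z\<close> from the sine series turns the prefactor of order
  \<open>1 / 2\<close> into that of order \<open>- 1 / 2\<close>, so both orders share one
  power.\<close>

lemma half_powr_half:
  "z \<noteq> 0 \<Longrightarrow> (z / 2) powr (1 / 2) * (2 / z) = (z / 2 :: complex) powr (- 1 / 2)"
  using powr_diff[of "z / 2" "1 / 2" 1] by (simp add: divide_simps)

lemma bessel_J_minus_half: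
  "bessel_J (- 1 / 2) z = (z / 2) powr (- 1 / 2) * cos z / of_real (sqrt pi)"
  unfolding bessel_J_def bessel_series_minus_half by simp

lemma bessel_J_half:
  assumes "z \<noteq> 0"
  shows "bessel_J (1 / 2) z = (z / 2) powr (- 1 / 2) * sin z / of_real (sqrt pi)"
  unfolding bessel_J_def bessel_series_half[OF assms] half_powr_half[OF assms, symmetric] by simp

lemma minus_one_power_mult_i_power:
  "(- 1) ^ k * (\<i> * z / 2) ^ (2 * k) = (z / 2 :: complex) ^ (2 * k)"
proof -
  have "(\<i> * z / 2) ^ (2 * k) = \<i> ^ (2 * k) * (z / 2) ^ (2 * k)"
    by (simp only: power_mult_distrib times_divide_eq_right[symmetric])
  also have "\<i> ^ (2 * k) = (- 1) ^ k"
    by (simp add: power_mult)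
  finally show ?thesis by simp
qed

text \<open>The series of \<open>I\<close> is that of \<open>J\<close> at \<open>\<i> * z\<close>.
  Only the entire factor is rotated, not the power in front, so no branch has to be tracked.\<close>

lemma bessel_I_series_eq:
  "(\<Sum>k. 1 / fact k * a k * (z / 2) ^ (2 * k)) =
    (\<Sum>k. (- 1) ^ k / fact k * a k * (\<i> * z / 2 :: complex) ^ (2 * k))"
proof -
  have "(- 1) ^ k / fact k * a k * (\<i> * z / 2) ^ (2 * k)
      = 1 / fact k * a k * ((- 1) ^ k * (\<i> * z / 2) ^ (2 * k))" for k
    by simp
  then show ?thesis
    by (simp only: minus_one_power_mult_i_power)
qed

lemma bessel_I_minus_half:
  "bessel_I (- 1 / 2) z = (z / 2) powr (- 1 / 2) * cosh z / of_real (sqrt pi)"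
  unfolding bessel_I_def bessel_I_series_eq bessel_series_minus_half by (simp add: cosh_conv_cos)

lemma bessel_I_half:
  assumes "z \<noteq> 0"
  shows "bessel_I (1 / 2) z = (z / 2) powr (- 1 / 2) * sinh z / of_real (sqrt pi)"
proof -
  have "\<i> * z \<noteq> 0" using assms by simp
  note * = bessel_series_half[OF this]
  show ?thesis
    unfolding bessel_I_def bessel_I_series_eq * half_powr_half[OF assms, symmetric]
    by (simp add: sinh_conv_sin divide_simps)
qed

section \<open>The hard-edge kernels\<close>

lemma integral_pos_scale:
  fixes f :: "real \<Rightarrow> complex"
  assumes "c > 0"
  shows "(LBINT x:{0<..}. f x) = of_real c * (LBINT x:{0<..}. f (c * x))"
proof -
  have "(LBINT x:{0<..}. f x) = c *\<^sub>R (LBINT x. indicator {0<..} (c * x) *\<^sub>R f (c * x))"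
    unfolding set_lebesgue_integral_def
    using lborel_integral_real_affine[of c "\<lambda>x. indicator {0<..} x *\<^sub>R f x" 0] assms by simp
  also have "(\<lambda>x. indicator {0<..} (c * x) *\<^sub>R f (c * x)) = (\<lambda>x. indicator {0<..} x *\<^sub>R f (c * x))"
    using assms by (auto simp: indicator_def zero_less_mult_iff)
  finally show ?thesis
    by (simp add: set_lebesgue_integral_def scaleR_conv_of_real)
qed

lemma C_integral_scale:
  assumes "c > 0"
  shows "C_integral f = of_real c * C_integral (\<lambda>z. f (of_real c * z))"
proof -
  have "ray_integral \<theta> f = of_real c * ray_integral \<theta> (\<lambda>z. f (of_real c * z))" for \<theta>
    unfolding ray_integral_def
    by (subst integral_pos_scale[OF assms]) (simp add: mult.assoc)
  then show ?thesis
    unfolding C_integral_def by (simp add: algebra_simps)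
qed

text \<open>The hard-edge integrand in the rescaled variables, where its exponential factor has
  become the Pearcey weight.\<close>

definition hard_integrand ::
    "real \<Rightarrow> real \<Rightarrow> real \<Rightarrow> real \<Rightarrow> real \<Rightarrow> complex \<Rightarrow> real \<Rightarrow> complex" where
  "hard_integrand \<alpha> s t \<xi> \<eta> z w =
     (of_real w / z) powr of_real \<alpha> * (of_real w * z / (z\<^sup>2 - (of_real w)\<^sup>2)) *
     pearcey_weight s t z (of_real w) * bessel_J \<alpha> (of_real \<eta> * of_real w) * bessel_J \<alpha> (of_real \<xi> * z)"

lemma ratio_powr:
  fixes \<xi> \<eta> :: real
  assumes "\<xi> > 0" "\<eta> > 0"
  shows "((2 powr (- 3 / 2) * \<eta>\<^sup>2) / (2 powr (- 3 / 2) * \<xi>\<^sup>2)) powr (\<alpha> / 2) = (\<eta> / \<xi>) powr \<alpha>"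
proof -
  have "(2 powr (- 3 / 2) * \<eta>\<^sup>2) / (2 powr (- 3 / 2) * \<xi>\<^sup>2) = (\<eta> / \<xi>) powr 2"
    using assms by (simp add: power_divide)
  then show ?thesis using assms by (simp only: powr_powr) simp
qed

text \<open>The substitution is \<open>u = 2 powr (- 1 / 4) * w\<close>, \<open>v = 2 powr (- 1 / 4) * z\<close>.\<close>

lemma hard_pearcey_tilde_rescaled:
  fixes s t \<xi> \<eta> :: real
  assumes "\<xi> > 0" "\<eta> > 0"
  shows "hard_pearcey_tilde \<alpha> (s / sqrt 2) (t / sqrt 2)
             (2 powr (- 3 / 2) * \<xi>\<^sup>2) (2 powr (- 3 / 2) * \<eta>\<^sup>2) =
    of_real ((\<eta> / \<xi>) powr \<alpha>) * (sqrt 2 / (of_real pi * \<i>)) *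
    C_integral (\<lambda>z. LBINT w:{0<..}. hard_integrand \<alpha> s t \<xi> \<eta> z w)"
proof -
  \<comment> \<open>The choice \<open>c^4 = 1 / 2\<close> turns \<open>v^4 / 2\<close> into
    \<open>z^4 / 4\<close>. Then \<open>c^2 / sqrt 2 = 1 / 2\<close> gives the quadratic terms, and
    \<open>2 * c^3 * c = 1\<close> the Bessel arguments, as
    \<open>2 powr (- 3 / 2) = c^6\<close>.\<close>
  define c :: real where "c = 2 powr (- 1 / 4)"
  have c: "c > 0" by (simp add: c_def)
  have c2: "c\<^sup>2 = 1 / sqrt 2"
    unfolding c_def by (subst powr_power) (simp_all add: powr_minus_divide powr_half_sqrt)
  have "c ^ 4 = (c\<^sup>2)\<^sup>2"
    by (simp flip: power_mult)
  then have c4: "c ^ 4 = 1 / 2"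
    by (simp add: c2 power_divide)
  have sx: "sqrt (2 powr (- 3 / 2) * x\<^sup>2) = c ^ 3 * x" if "x > 0" for x
  proof (rule real_sqrt_unique)
    show "(c ^ 3 * x)\<^sup>2 = 2 powr (- 3 / 2) * x\<^sup>2"
      by (simp add: power_mult_distrib c_def powr_power flip: power_mult)
  qed (use c that in simp)
  have bessel_arg: "2 * complex_of_real (c ^ 3 * x) * (of_real c * y) = of_real x * y" for x y
  proof -
    have "2 * complex_of_real (c ^ 3 * x) * (of_real c * y) = 2 * of_real (c ^ 4) * (of_real x * y)"
      by (simp add: eval_nat_numeral)
    then show ?thesis by (simp add: c4)
  qed
  have weight: "exp ((of_real c * z) ^ 4 / 2 + complex_of_real (s / sqrt 2) * (of_real c * z)\<^sup>2) /
      exp ((of_real c * w) ^ 4 / 2 + complex_of_real (t / sqrt 2) * (of_real c * w)\<^sup>2)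
      = pearcey_weight s t z w" for z w
  proof -
    have c4': "(of_real c * x) ^ 4 / 2 = x ^ 4 / 4" for x :: complex
      by (simp add: power_mult_distrib c4 flip: of_real_power)
    have c2': "complex_of_real (r / sqrt 2) * (of_real c * x)\<^sup>2 = of_real r * x\<^sup>2 / 2" for x r
      by (simp add: power_mult_distrib c2 flip: of_real_power of_real_mult)
    show ?thesis unfolding c4' c2' pearcey_weight_def ..
  qed
  \<comment> \<open>The power and the rational factor are homogeneous of degree \<open>0\<close>, so
    \<open>c\<close> survives only in the two Jacobians, which give
    \<open>2 * c^2 = sqrt 2\<close>.\<close>
  have base: "of_real (c * w) / (of_real c * z) = of_real w / (z :: complex)" for w z
    using c by simp
  have pole: "of_real (c * w) * (of_real c * z) / ((of_real c * z)\<^sup>2 - (of_real (c * w))\<^sup>2)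
      = of_real w * z / (z\<^sup>2 - (of_real w)\<^sup>2 :: complex)" for w z
  proof -
    have "of_real (c * w) * (of_real c * z) / ((of_real c * z)\<^sup>2 - (of_real (c * w))\<^sup>2)
      = (of_real (c\<^sup>2) * (of_real w * z)) / (of_real (c\<^sup>2) * (z\<^sup>2 - (of_real w)\<^sup>2 :: complex))"
      by (simp add: power2_eq_square algebra_simps)
    then show ?thesis using c by simp
  qed
  define h where "h v u =
       (complex_of_real u / v) powr complex_of_real \<alpha> *
       (complex_of_real u * v / (v\<^sup>2 - (complex_of_real u)\<^sup>2)) *
       (exp (v ^ 4 / 2 + complex_of_real (s / sqrt 2) * v\<^sup>2) /
        exp ((complex_of_real u) ^ 4 / 2 + complex_of_real (t / sqrt 2) * (complex_of_real u)\<^sup>2)) *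
       bessel_J \<alpha> (2 * complex_of_real (c ^ 3 * \<eta>) * complex_of_real u) *
       bessel_J \<alpha> (2 * complex_of_real (c ^ 3 * \<xi>) * v)" for v u
  have h: "h (of_real c * z) (c * w) = hard_integrand \<alpha> s t \<xi> \<eta> z w" for z w
    unfolding h_def base pole bessel_arg hard_integrand_def
    \<comment> \<open>\<open>base\<close> and \<open>pole\<close> match
      \<open>of_real (c * w)\<close> as a whole; it is split only afterwards, for the weight and the
      Bessel argument in \<open>w\<close>.\<close>
    unfolding of_real_mult[of c w] weight bessel_arg ..
  have "hard_pearcey_tilde \<alpha> (s / sqrt 2) (t / sqrt 2)
             (2 powr (- 3 / 2) * \<xi>\<^sup>2) (2 powr (- 3 / 2) * \<eta>\<^sup>2) =
    of_real ((\<eta> / \<xi>) powr \<alpha>) * (2 / (of_real pi * \<i>)) *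
    C_integral (\<lambda>v. LBINT u:{0<..}. h v u)"
    unfolding hard_pearcey_tilde_def ratio_powr[OF assms] h_def by (simp only: sx assms)
  also have "C_integral (\<lambda>v. LBINT u:{0<..}. h v u)
      = of_real c * C_integral (\<lambda>z. LBINT u:{0<..}. h (of_real c * z) u)"
    by (rule C_integral_scale[OF c])
  also have "(\<lambda>z. LBINT u:{0<..}. h (of_real c * z) u)
      = (\<lambda>z. of_real c * (LBINT w:{0<..}. hard_integrand \<alpha> s t \<xi> \<eta> z w))"
    by (subst integral_pos_scale[OF c]) (simp only: h)
  also have "C_integral \<dots> = of_real c * C_integral (\<lambda>z. LBINT w:{0<..}. hard_integrand \<alpha> s t \<xi> \<eta> z w)"
    by (rule C_integral_cmult)
  also have "of_real ((\<eta> / \<xi>) powr \<alpha>) * (2 / (of_real pi * \<i>)) * (of_real c * (of_real c * I))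
      = of_real ((\<eta> / \<xi>) powr \<alpha>) * (of_real (2 * c\<^sup>2) / (of_real pi * \<i>)) * I" for I
    by (simp add: power2_eq_square)
  also have "2 * c\<^sup>2 = sqrt 2"
    by (simp add: c2 real_div_sqrt)
  finally show ?thesis .
qed

section \<open>Elementary form of the hard-edge integrand at orders plus or minus one half\<close>

lemma Ln_of_real_mult_half:
  assumes "r > 0" "z \<noteq> 0"
  shows "Ln (of_real r * z / 2) = of_real (ln (r / 2)) + Ln z"
  using Ln_times_of_real[of "r / 2" z] Ln_of_real[of "r / 2"] assms by simp

text \<open>With \<open>Re z > 0\<close> and the other quantities positive, all logarithms split
  without branch corrections. In the total exponent \<open>Ln z\<close> cancels for order
  \<open>- 1 / 2\<close> and \<open>ln w\<close> cancels for order \<open>1 / 2\<close>, which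
  leaves \<open>1 / w\<close> and \<open>1 / z\<close>.\<close>

lemma
  assumes "Re z > 0" "w > 0" "\<xi> > 0" "\<eta> > 0"
  shows powr_product_minus_half:
     "(of_real w / z) powr (- 1 / 2) *
      ((of_real \<eta> * of_real w / 2) powr (- 1 / 2) * (of_real \<xi> * z / 2) powr (- 1 / 2)) =
      of_real (2 / sqrt (\<xi> * \<eta>)) / of_real w" (is ?minus)
    and powr_product_half:
     "(of_real w / z) powr (1 / 2) *
      ((of_real \<eta> * of_real w / 2) powr (- 1 / 2) * (of_real \<xi> * z / 2) powr (- 1 / 2)) =
      of_real (2 / sqrt (\<xi> * \<eta>)) / z" (is ?plus)
proof -
  have z: "z \<noteq> 0" "z \<notin> \<real>\<^sub>\<le>\<^sub>0" using assms by (auto simp: complex_nonpos_Reals_iff)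
  have 1: "Ln (of_real w / z) = of_real (ln w) - Ln z"
    using Ln_times_of_real[of w "inverse z"] z assms by (simp add: Ln_inverse divide_inverse Ln_of_real)
  have 2: "Ln (of_real \<eta> * of_real w / 2) = of_real (ln (\<eta> / 2)) + of_real (ln w)"
    using Ln_of_real_mult_half[of \<eta> "of_real w"] assms by (simp add: Ln_of_real)
  have 3: "Ln (of_real \<xi> * z / 2) = of_real (ln (\<xi> / 2)) + Ln z"
    using Ln_of_real_mult_half[of \<xi> z] assms z by simp
  have nz: "of_real w / z \<noteq> 0" "of_real \<eta> * of_real w / (2 :: complex) \<noteq> 0" "of_real \<xi> * z / 2 \<noteq> 0"
    using assms z by auto
  have k: "exp (of_real (- (ln (\<eta> / 2) + ln (\<xi> / 2)) / 2)) = complex_of_real (2 / sqrt (\<xi> * \<eta>))"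
  proof -
    have "ln 4 = 2 * ln (2 :: real)"
      using ln_realpow[of 2 2] by simp
    then have "exp (- (ln (\<eta> / 2) + ln (\<xi> / 2)) / 2) = (\<xi> * \<eta> / 4) powr (- 1 / 2)"
      using assms by (simp add: powr_def ln_mult ln_div field_simps)
    also have "\<dots> = 2 / sqrt (\<xi> * \<eta>)"
      using assms by (simp add: powr_minus_divide powr_half_sqrt real_sqrt_divide)
    finally show ?thesis by (simp only: exp_of_real)
  qed
  have powr: "x powr a = exp (a * Ln x)" if "x \<noteq> 0" for x a :: complex
    using that by (simp add: powr_def)
  have w: "exp (- of_real (ln w)) = 1 / complex_of_real w" "exp (- Ln z) = 1 / z"
    using assms z by (simp_all add: exp_minus inverse_eq_divide exp_of_real)
  have "(of_real w / z) powr (- 1 / 2) *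
      ((of_real \<eta> * of_real w / 2) powr (- 1 / 2) * (of_real \<xi> * z / 2) powr (- 1 / 2))
    = exp (of_real (- (ln (\<eta> / 2) + ln (\<xi> / 2)) / 2)) * exp (- of_real (ln w))"
    unfolding powr[OF nz(1)] powr[OF nz(2)] powr[OF nz(3)] 1 2 3 exp_add[symmetric]
    by (rule arg_cong[where f = exp]) (simp add: field_simps)
  then show ?minus unfolding k w by simp
  have "(of_real w / z) powr (1 / 2) *
      ((of_real \<eta> * of_real w / 2) powr (- 1 / 2) * (of_real \<xi> * z / 2) powr (- 1 / 2))
    = exp (of_real (- (ln (\<eta> / 2) + ln (\<xi> / 2)) / 2)) * exp (- Ln z)"
    unfolding powr[OF nz(1)] powr[OF nz(2)] powr[OF nz(3)] 1 2 3 exp_add[symmetric]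
    by (rule arg_cong[where f = exp]) (simp add: field_simps)
  then show ?plus unfolding k w by simp
qed

text \<open>The remaining \<open>1 / w\<close> or \<open>1 / z\<close> reduces the numerator
  \<open>w * z\<close> to \<open>z\<close> or \<open>w\<close>, and the two factors
  \<open>1 / sqrt pi\<close> of the Bessel functions give \<open>1 / pi\<close>.\<close>

lemma
  assumes "Re z > 0" "w > 0" "\<xi> > 0" "\<eta> > 0"
  shows hard_integrand_minus_half:
     "hard_integrand (- 1 / 2) s t \<xi> \<eta> z w = of_real (2 / (pi * sqrt (\<xi> * \<eta>))) *
       (z / (z\<^sup>2 - (of_real w)\<^sup>2) * pearcey_weight s t z (of_real w)
        * cos (of_real \<eta> * of_real w) * cos (of_real \<xi> * z))" (is ?minus)
    and hard_integrand_half: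
     "hard_integrand (1 / 2) s t \<xi> \<eta> z w = of_real (2 / (pi * sqrt (\<xi> * \<eta>))) *
       (of_real w / (z\<^sup>2 - (of_real w)\<^sup>2) * pearcey_weight s t z (of_real w)
        * sin (of_real \<eta> * of_real w) * sin (of_real \<xi> * z))" (is ?plus)
proof -
  let ?B = "(of_real \<eta> * of_real w / 2) powr (- 1 / 2) * (of_real \<xi> * z / 2) powr (- 1 / 2) :: complex"
  have nz: "complex_of_real \<eta> * of_real w \<noteq> 0" "of_real \<xi> * z \<noteq> 0" "z \<noteq> 0" "w \<noteq> 0"
    using assms by auto
  have pi: "complex_of_real (sqrt pi) * of_real (sqrt pi) = of_real pi"
    by (simp flip: of_real_mult)
  have "hard_integrand (- 1 / 2) s t \<xi> \<eta> z w =
     ((of_real w / z) powr (- 1 / 2) * ?B) * (of_real w * z / (z\<^sup>2 - (of_real w)\<^sup>2)) *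
     pearcey_weight s t z (of_real w) * cos (of_real \<eta> * of_real w) * cos (of_real \<xi> * z) /
     (of_real (sqrt pi) * of_real (sqrt pi))"
    unfolding hard_integrand_def bessel_J_minus_half by (simp add: mult_ac)
  then show ?minus
    unfolding powr_product_minus_half[OF assms] pi using nz by (simp add: mult_ac)
  have "hard_integrand (1 / 2) s t \<xi> \<eta> z w =
     ((of_real w / z) powr (1 / 2) * ?B) * (of_real w * z / (z\<^sup>2 - (of_real w)\<^sup>2)) *
     pearcey_weight s t z (of_real w) * sin (of_real \<eta> * of_real w) * sin (of_real \<xi> * z) /
     (of_real (sqrt pi) * of_real (sqrt pi))"
    unfolding hard_integrand_def bessel_J_half[OF nz(1)] bessel_J_half[OF nz(2)] by (simp add: mult_ac)
  then show ?plus
    unfolding powr_product_half[OF assms] pi using nz by (simp add: mult_ac)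
qed

text \<open>The bookkeeping common to both orders: \<open>p\<close> is \<open>\<eta>\<close> or
  \<open>\<xi>\<close>, and \<open>k\<close> is the constant taken out of the integrand.\<close>

lemma hard_pearcey_tilde_prefactor:
  assumes "\<xi> > 0" "\<eta> > 0"
    and prefactor: "p / sqrt 2 * ((\<eta> / \<xi>) powr \<alpha> * (sqrt 2 * k)) = 2 / pi"
    and integral: "C_integral (\<lambda>z. LBINT w:{0<..}. hard_integrand \<alpha> s t \<xi> \<eta> z w) = of_real k * I"
  shows "of_real (p / sqrt 2) * hard_pearcey_tilde \<alpha> (s / sqrt 2) (t / sqrt 2)
             (2 powr (- 3 / 2) * \<xi>\<^sup>2) (2 powr (- 3 / 2) * \<eta>\<^sup>2) =
     2 / (of_real pi ^ 2 * \<i>) * I"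
proof -
  have "of_real (p / sqrt 2) * (of_real ((\<eta> / \<xi>) powr \<alpha>) * (sqrt 2 / (of_real pi * \<i>)) * (of_real k * I))
    = of_real (p / sqrt 2 * ((\<eta> / \<xi>) powr \<alpha> * (sqrt 2 * k))) * I / (of_real pi * \<i>)"
    by simp
  also have "\<dots> = 2 / (of_real pi ^ 2 * \<i>) * I"
    unfolding prefactor by (simp add: power2_eq_square)
  finally show ?thesis
    unfolding hard_pearcey_tilde_rescaled[OF assms(1,2)] integral .
qed

text \<open>The asymmetric factors \<open>\<eta>\<close> and \<open>\<xi>\<close> compensate the
  powers of \<open>\<eta> / \<xi>\<close>, so both orders end with the symmetric
  \<open>sqrt (\<xi> * \<eta>)\<close>. The free \<open>k\<close> lets this serve the double
  integrals and the Gaussian terms alike.\<close>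

lemma
  assumes "\<xi> > 0" "\<eta> > 0"
  shows prefactor_minus_half:
      "\<eta> / sqrt 2 * ((\<eta> / \<xi>) powr (- 1 / 2) * (sqrt 2 * k)) = sqrt (\<xi> * \<eta>) * k"
    and prefactor_half:
      "\<xi> / sqrt 2 * ((\<eta> / \<xi>) powr (1 / 2) * (sqrt 2 * k)) = sqrt (\<xi> * \<eta>) * k"
  using assms real_sqrt_mult_self[of \<xi>] real_sqrt_mult_self[of \<eta>]
  by (simp_all add: powr_minus_divide powr_half_sqrt real_sqrt_divide real_sqrt_mult divide_simps)

lemma hard_pearcey_tilde_minus_half:
  assumes "\<xi> > 0" "\<eta> > 0"
  shows "of_real (\<eta> / sqrt 2) * hard_pearcey_tilde (- 1 / 2) (s / sqrt 2) (t / sqrt 2)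
             (2 powr (- 3 / 2) * \<xi>\<^sup>2) (2 powr (- 3 / 2) * \<eta>\<^sup>2) =
     2 / (of_real pi ^ 2 * \<i>) * even_double_integral s t \<xi> \<eta>"
proof (rule hard_pearcey_tilde_prefactor[OF assms])
  show "\<eta> / sqrt 2 * ((\<eta> / \<xi>) powr (- 1 / 2) * (sqrt 2 * (2 / (pi * sqrt (\<xi> * \<eta>))))) = 2 / pi"
    unfolding prefactor_minus_half[OF assms] using assms by simp
  show "C_integral (\<lambda>z. LBINT w:{0<..}. hard_integrand (- 1 / 2) s t \<xi> \<eta> z w)
      = of_real (2 / (pi * sqrt (\<xi> * \<eta>))) * even_double_integral s t \<xi> \<eta>"
    unfolding even_double_integral_def C_integral_cmult[symmetric] set_integral_mult_right[symmetric]
    by (intro C_integral_cong set_lebesgue_integral_cong allI impI hard_integrand_minus_half assms) auto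
qed

lemma hard_pearcey_tilde_half:
  assumes "\<xi> > 0" "\<eta> > 0"
  shows "of_real (\<xi> / sqrt 2) * hard_pearcey_tilde (1 / 2) (s / sqrt 2) (t / sqrt 2)
             (2 powr (- 3 / 2) * \<xi>\<^sup>2) (2 powr (- 3 / 2) * \<eta>\<^sup>2) =
     2 / (of_real pi ^ 2 * \<i>) * odd_double_integral s t \<xi> \<eta>"
proof (rule hard_pearcey_tilde_prefactor[OF assms])
  show "\<xi> / sqrt 2 * ((\<eta> / \<xi>) powr (1 / 2) * (sqrt 2 * (2 / (pi * sqrt (\<xi> * \<eta>))))) = 2 / pi"
    unfolding prefactor_half[OF assms] using assms by simp
  show "C_integral (\<lambda>z. LBINT w:{0<..}. hard_integrand (1 / 2) s t \<xi> \<eta> z w)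
      = of_real (2 / (pi * sqrt (\<xi> * \<eta>))) * odd_double_integral s t \<xi> \<eta>"
    unfolding odd_double_integral_def C_integral_cmult[symmetric] set_integral_mult_right[symmetric]
    by (intro C_integral_cong set_lebesgue_integral_cong allI impI hard_integrand_half assms) auto
qed

section \<open>The Gaussian terms subtracted for \<open>s < t\<close>\<close>

lemma hard_pearcey_phi_rescaled:
  assumes "\<xi> > 0" "\<eta> > 0" "s < t"
  shows "hard_pearcey_phi \<alpha> (s / sqrt 2) (t / sqrt 2)
             (2 powr (- 3 / 2) * \<xi>\<^sup>2) (2 powr (- 3 / 2) * \<eta>\<^sup>2) =
    of_real ((\<eta> / \<xi>) powr \<alpha> * (sqrt 2 * (exp (- ((\<xi>\<^sup>2 + \<eta>\<^sup>2) / (2 * (t - s)))) / (t - s)))) *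
    bessel_I \<alpha> (of_real (\<xi> * \<eta> / (t - s)))"
proof -
  have k: "(2 :: real) powr (- 3 / 2) = 1 / (2 * sqrt 2)"
    using powr_add[of 2 1 "1 / 2 :: real"] by (simp add: powr_minus_divide powr_half_sqrt)
  have t: "t / sqrt 2 - s / sqrt 2 = (t - s) / sqrt 2"
    by (simp add: diff_divide_distrib)
  have "sqrt (2 powr (- 3 / 2) * \<xi>\<^sup>2 * (2 powr (- 3 / 2) * \<eta>\<^sup>2)) = \<xi> * \<eta> / (2 * sqrt 2)"
    unfolding k using assms by (intro real_sqrt_unique) (simp_all add: power2_eq_square)
  then have arg: "2 * sqrt (2 powr (- 3 / 2) * \<xi>\<^sup>2 * (2 powr (- 3 / 2) * \<eta>\<^sup>2)) / ((t - s) / sqrt 2)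
      = \<xi> * \<eta> / (t - s)"
    by simp
  have ex: "(2 powr (- 3 / 2) * \<xi>\<^sup>2 + 2 powr (- 3 / 2) * \<eta>\<^sup>2) / ((t - s) / sqrt 2)
      = (\<xi>\<^sup>2 + \<eta>\<^sup>2) / (2 * (t - s))"
    unfolding k using assms by (simp add: divide_simps)
  show ?thesis
    unfolding hard_pearcey_phi_def t ratio_powr[OF assms(1,2)] arg ex by (simp add: mult_ac)
qed

text \<open>Expanding the square separates a factor even in \<open>\<eta>\<close> from
  \<open>exp (\<xi> * \<eta> / (t - s))\<close>, so adding or subtracting the reflected term gives
  twice \<open>cosh\<close> or \<open>sinh\<close>.\<close>

lemma
  assumes "s < t"
  shows pearcey_phi_even: "pearcey_phi s t \<xi> \<eta> + pearcey_phi s t \<xi> (- \<eta>) =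
      sqrt (2 / (pi * (t - s))) * exp (- ((\<xi>\<^sup>2 + \<eta>\<^sup>2) / (2 * (t - s)))) * cosh (\<xi> * \<eta> / (t - s))"
    and pearcey_phi_odd: "pearcey_phi s t \<xi> \<eta> - pearcey_phi s t \<xi> (- \<eta>) =
      sqrt (2 / (pi * (t - s))) * exp (- ((\<xi>\<^sup>2 + \<eta>\<^sup>2) / (2 * (t - s)))) * sinh (\<xi> * \<eta> / (t - s))"
proof -
  have "pearcey_phi s t \<xi> y = sqrt (2 / (pi * (t - s))) / 2 *
      (exp (- ((\<xi>\<^sup>2 + y\<^sup>2) / (2 * (t - s)))) * exp (\<xi> * y / (t - s)))" for y
  proof -
    have "1 / sqrt (2 * pi * (t - s)) = sqrt (2 / (pi * (t - s))) / 2"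
      using assms by (simp add: real_sqrt_divide real_sqrt_mult divide_simps)
    moreover have "- ((\<xi> - y)\<^sup>2 / (2 * (t - s))) = - ((\<xi>\<^sup>2 + y\<^sup>2) / (2 * (t - s))) + \<xi> * y / (t - s)"
      using assms by (simp add: divide_simps power2_diff) (simp add: algebra_simps)
    ultimately show ?thesis
      unfolding pearcey_phi_def by (simp only: exp_add)
  qed
  then show "pearcey_phi s t \<xi> \<eta> + pearcey_phi s t \<xi> (- \<eta>) =
      sqrt (2 / (pi * (t - s))) * exp (- ((\<xi>\<^sup>2 + \<eta>\<^sup>2) / (2 * (t - s)))) * cosh (\<xi> * \<eta> / (t - s))"
    "pearcey_phi s t \<xi> \<eta> - pearcey_phi s t \<xi> (- \<eta>) =
      sqrt (2 / (pi * (t - s))) * exp (- ((\<xi>\<^sup>2 + \<eta>\<^sup>2) / (2 * (t - s)))) * sinh (\<xi> * \<eta> / (t - s))"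
    by (simp_all add: cosh_field_def sinh_field_def algebra_simps)
qed

text \<open>The scalar comparison left for both orders, applied with
  \<open>u = \<xi> * \<eta>\<close>, \<open>\<tau> = t - s\<close> and \<open>e\<close> the Gaussian
  factor.\<close>

lemma phi_constant:
  fixes u \<tau> :: real
  assumes "u > 0" "\<tau> > 0"
  shows "sqrt u * (e / \<tau>) * (u / \<tau> / 2) powr (- 1 / 2) / sqrt pi = sqrt (2 / (pi * \<tau>)) * e"
proof -
  have "sqrt u * (e / \<tau>) * (u / \<tau> / 2) powr (- 1 / 2) / sqrt pi = e * (sqrt \<tau> * sqrt 2 / (\<tau> * sqrt pi))"
    using assms by (simp add: powr_minus_divide powr_half_sqrt real_sqrt_divide real_sqrt_mult)
  also have "sqrt \<tau> * sqrt 2 / (\<tau> * sqrt pi) = sqrt (2 / (pi * \<tau>))"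
    using assms real_sqrt_mult_self[of \<tau>]
    by (simp add: real_sqrt_divide real_sqrt_mult divide_simps)
  finally show ?thesis by simp
qed

lemma complex_of_real_cosh: "cosh (complex_of_real x) = of_real (cosh x)"
  and complex_of_real_sinh: "sinh (complex_of_real x) = of_real (sinh x)"
  by (simp_all add: cosh_field_def sinh_field_def flip: exp_of_real)

lemma of_real_half_powr:
  "0 \<le> x \<Longrightarrow> (complex_of_real x / 2) powr (- 1 / 2) = of_real ((x / 2) powr (- 1 / 2))"
  using powr_of_real[of "x / 2" "- 1 / 2"] by simp

lemma bessel_I_minus_half_of_real:
  assumes "x > 0"
  shows "bessel_I (- 1 / 2) (of_real x) = of_real ((x / 2) powr (- 1 / 2) * cosh x / sqrt pi)"
  using assms by (simp only: bessel_I_minus_half of_real_half_powr less_imp_le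
      complex_of_real_cosh of_real_mult of_real_divide)

lemma bessel_I_half_of_real:
  assumes "x > 0"
  shows "bessel_I (1 / 2) (of_real x) = of_real ((x / 2) powr (- 1 / 2) * sinh x / sqrt pi)"
proof -
  have "complex_of_real x \<noteq> 0" using assms by simp
  from bessel_I_half[OF this] show ?thesis
    using assms by (simp only: of_real_half_powr less_imp_le
      complex_of_real_sinh of_real_mult of_real_divide)
qed

text \<open>Order \<open>- 1 / 2\<close> turns \<open>bessel_I\<close> into \<open>cosh\<close>,
  which is what the sum of the two Gaussians produces.\<close>

lemma hard_pearcey_phi_minus_half:
  assumes "\<xi> > 0" "\<eta> > 0" "s < t"
  shows "of_real (\<eta> / sqrt 2) * hard_pearcey_phi (- 1 / 2) (s / sqrt 2) (t / sqrt 2)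
             (2 powr (- 3 / 2) * \<xi>\<^sup>2) (2 powr (- 3 / 2) * \<eta>\<^sup>2) =
    of_real (pearcey_phi s t \<xi> \<eta> + pearcey_phi s t \<xi> (- \<eta>))"
proof -
  let ?e = "exp (- ((\<xi>\<^sup>2 + \<eta>\<^sup>2) / (2 * (t - s))))" and ?x = "\<xi> * \<eta> / (t - s)"
  have x: "?x > 0" "\<xi> * \<eta> > 0" "t - s > 0" using assms by simp_all
  have "of_real (\<eta> / sqrt 2) * hard_pearcey_phi (- 1 / 2) (s / sqrt 2) (t / sqrt 2)
             (2 powr (- 3 / 2) * \<xi>\<^sup>2) (2 powr (- 3 / 2) * \<eta>\<^sup>2) =
    of_real ((\<eta> / sqrt 2 * ((\<eta> / \<xi>) powr (- 1 / 2) * (sqrt 2 * (?e / (t - s)))))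
       * (?x / 2) powr (- 1 / 2) / sqrt pi * cosh ?x)"
    unfolding hard_pearcey_phi_rescaled[OF assms] bessel_I_minus_half_of_real[OF x(1)] of_real_mult[symmetric] by (simp add: mult_ac)
  also have "\<dots> = of_real (sqrt (2 / (pi * (t - s))) * ?e * cosh ?x)"
    unfolding prefactor_minus_half[OF assms(1,2)] phi_constant[OF x(2,3)] ..
  finally show ?thesis unfolding pearcey_phi_even[OF assms(3)] .
qed

lemma hard_pearcey_phi_half:
  assumes "\<xi> > 0" "\<eta> > 0" "s < t"
  shows "of_real (\<xi> / sqrt 2) * hard_pearcey_phi (1 / 2) (s / sqrt 2) (t / sqrt 2)
             (2 powr (- 3 / 2) * \<xi>\<^sup>2) (2 powr (- 3 / 2) * \<eta>\<^sup>2) =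
    of_real (pearcey_phi s t \<xi> \<eta> - pearcey_phi s t \<xi> (- \<eta>))"
proof -
  let ?e = "exp (- ((\<xi>\<^sup>2 + \<eta>\<^sup>2) / (2 * (t - s))))" and ?x = "\<xi> * \<eta> / (t - s)"
  have x: "?x > 0" "\<xi> * \<eta> > 0" "t - s > 0" using assms by simp_all
  have "of_real (\<xi> / sqrt 2) * hard_pearcey_phi (1 / 2) (s / sqrt 2) (t / sqrt 2)
             (2 powr (- 3 / 2) * \<xi>\<^sup>2) (2 powr (- 3 / 2) * \<eta>\<^sup>2) =
    of_real ((\<xi> / sqrt 2 * ((\<eta> / \<xi>) powr (1 / 2) * (sqrt 2 * (?e / (t - s)))))
       * (?x / 2) powr (- 1 / 2) / sqrt pi * sinh ?x)"
    unfolding hard_pearcey_phi_rescaled[OF assms] bessel_I_half_of_real[OF x(1)] of_real_mult[symmetric] by (simp add: mult_ac)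
  also have "\<dots> = of_real (sqrt (2 / (pi * (t - s))) * ?e * sinh ?x)"
    unfolding prefactor_half[OF assms(1,2)] phi_constant[OF x(2,3)] ..
  finally show ?thesis unfolding pearcey_phi_odd[OF assms(3)] .
qed

theorem proposition1p2:
  fixes s t \<xi> \<eta> :: real
  assumes "\<xi> > 0" and "\<eta> > 0"
  shows "pearcey_kernel_even s t \<xi> \<eta> =
           complex_of_real (\<eta> / sqrt 2) *
           hard_pearcey_kernel (- 1 / 2) (s / sqrt 2) (t / sqrt 2)
             (2 powr (- 3 / 2) * \<xi>\<^sup>2) (2 powr (- 3 / 2) * \<eta>\<^sup>2) \<and>
         pearcey_kernel_odd s t \<xi> \<eta> =
           complex_of_real (\<xi> / sqrt 2) *
           hard_pearcey_kernel (1 / 2) (s / sqrt 2) (t / sqrt 2)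
             (2 powr (- 3 / 2) * \<xi>\<^sup>2) (2 powr (- 3 / 2) * \<eta>\<^sup>2)"
proof -
  \<comment> \<open>Rescaling time by a positive factor keeps the order, so both sides subtract
    their Gaussian term in the same case.\<close>
  have less: "s / sqrt 2 < t / sqrt 2 \<longleftrightarrow> s < t"
    by (simp add: divide_less_cancel)
  have "pearcey_kernel_even s t \<xi> \<eta> = pearcey_tilde s t \<xi> \<eta> + pearcey_tilde s t \<xi> (- \<eta>)
      - (if s < t then of_real (pearcey_phi s t \<xi> \<eta> + pearcey_phi s t \<xi> (- \<eta>)) else 0)"
    unfolding pearcey_kernel_even_def pearcey_kernel_def by simp
  moreover have "pearcey_kernel_odd s t \<xi> \<eta> = pearcey_tilde s t \<xi> \<eta> - pearcey_tilde s t \<xi> (- \<eta>)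
      - (if s < t then of_real (pearcey_phi s t \<xi> \<eta> - pearcey_phi s t \<xi> (- \<eta>)) else 0)"
    unfolding pearcey_kernel_odd_def pearcey_kernel_def by simp
  \<comment> \<open>The double integrals agree for all \<open>s\<close> and \<open>t\<close> and are
    rewritten at once; the Gaussian identities assume \<open>s < t\<close> and enter through the
    case split.\<close>
  ultimately show ?thesis
    unfolding hard_pearcey_kernel_def right_diff_distrib less
      pearcey_tilde_even pearcey_tilde_odd
      hard_pearcey_tilde_minus_half[OF assms] hard_pearcey_tilde_half[OF assms]
    using hard_pearcey_phi_minus_half[OF assms] hard_pearcey_phi_half[OF assms]
    by (cases "s < t") (simp_all only: if_True if_False mult_zero_right)
qed

end
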